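(* Let $J$ be a proper ideal of ${}^\bullet\mathbb{R}$ and let $b\in J$. Set $$O(J):=\{\omega(j)\in\mathbb{R}_{\ge0}\mid j\in J\},\qquad a:=\sup O(J)\in\mathbb{R}_{\ge0}\cup\{\infty\}.$$ Then: (1) for every $c\in{}^\bullet\mathbb{R}$, if $-b<c<b$ then $c\in J$; (2) if $a\in O(J)$, then $J=I_a:=\{x\in D_\infty\mid\omega(x)\le a\}$; (3) if $a\notin O(J)$, then $a\ge1$ and $J=D_{a-1}$, i.e. $J=\{x\in D_\infty\mid\omega(x)<a\}$.
   Context: Fermat reals. A little-oh polynomial is a function $x:\mathbb{R}_{\ge0}\to\mathbb{R}$ such that $x(t)=r+\sum_{i=1}^N a_i t^{\alpha_i}+o(t)$ as $t\to0^+$, for some $N\in\mathbb{N}$, $r,a_i\in\mathbb{R}$, $\alpha_i\in\mathbb{R}_{\ge0}$. Put $x\sim y$ iff $x(t)=y(t)+o(t)$ as $t\to0^+$. The ring ${}^\bullet\mathbb{R}$ of Fermat reals is the quotient of the ring of little-oh polynomials (pointwise operations) by $\sim$; it contains $\mathbb{R}$ (classes of constants). For real $a>0$, $\mathrm{d}t_a$ denotes the class of $t\mapsto t^{1/a}$ (so $\mathrm{d}t_a=0$ iff $a<1$). Every $x\in{}^\bullet\mathbb{R}$ can be written uniquely as $x={}^\circ x+\sum_{i=1}^N\alpha_i\,\mathrm{d}t_{a_i}$ with ${}^\circ x,\alpha_i\in\mathbb{R}$, $\alpha_i\ne0$, $a_1>\dots>a_N\ge1$, $N\ge0$ (the decomposition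 of $x$). ${}^\circ x$ is the standard part of $x$, and the order is $\omega(x):=a_1$ if $N\ge1$, $\omega(x):=0$ if $x\in\mathbb{R}$. $D_\infty:=\{x\in{}^\bullet\mathbb{R}\mid{}^\circ x=0\}$, and for $c\in\mathbb{R}_{\ge0}\cup\{\infty\}$, $D_c:=\{x\in{}^\bullet\mathbb{R}\mid{}^\circ x=0,\ \omega(x)<c+1\}$, with the convention $\infty\pm1=\infty$. Order relation: ${}^\bullet\mathbb{R}$ is totally ordered by: $x>0$ iff either ${}^\circ x>0$, or ${}^\circ x=0$, $x\neq 0$ and the first coefficient $\alpha_1$ in the decomposition of $x$ is positive; and $x<y$ iff $y-x>0$. *)

theory Defs
  imports "HOL-Analysis.Analysis" "HOL-Library.Landau_Symbols" "HOL-Algebra.Ideal"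
begin

section \<open>Little-oh polynomials\<close>

text \<open>
  A function on the nonnegative reals is represented by a function on all reals. Its values at
  negative arguments play no role, since every condition below is stated along the filter
  \<^term>\<open>at_right (0::real)\<close>; in the quotient, functions that agree on the positive reals are
  identified.
\<close>

definition little_oh_poly :: "(real \<Rightarrow> real) \<Rightarrow> bool" where
  "little_oh_poly x \<longleftrightarrow>
     (\<exists>(r::real) (N::nat) (a :: nat \<Rightarrow> real) (\<alpha> :: nat \<Rightarrow> real).
        (\<forall>i\<in>{1..N}. 0 \<le> \<alpha> i) \<and>
        (\<lambda>t. x t - (r + (\<Sum>i=1..N. a i * t powr \<alpha> i))) \<in> o[at_right 0](\<lambda>t. t))"

definition fermat_rel :: "(real \<Rightarrow> real) \<Rightarrow> (real \<Rightarrow> real) \<Rightarrow> bool" where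
  "fermat_rel x y \<longleftrightarrow> little_oh_poly x \<and> little_oh_poly y \<and>
     (\<lambda>t. x t - y t) \<in> o[at_right 0](\<lambda>t. t)"

lemma eventually_at_right_0_pos: "eventually (\<lambda>t::real. 0 < t \<and> t < 1) (at_right 0)"
  by (rule eventually_at_rightI[of 0 1]) auto

lemma little_oh_poly_smallo:
  assumes "x \<in> o[at_right 0](\<lambda>t. t)"
  shows "little_oh_poly x"
  unfolding little_oh_poly_def
  by (rule exI[of _ 0], rule exI[of _ 0]) (use assms in simp)

lemma little_oh_poly_monom:
  assumes "0 \<le> p"
  shows "little_oh_poly (\<lambda>t. c * t powr p)"
  unfolding little_oh_poly_def
  by (rule exI[of _ 0], rule exI[of _ 1], rule exI[of _ "\<lambda>_. c"], rule exI[of _ "\<lambda>_. p"])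
     (use assms in simp)

lemma little_oh_poly_const: "little_oh_poly (\<lambda>_. r)"
  unfolding little_oh_poly_def
  by (rule exI[of _ r], rule exI[of _ 0]) simp

lemma little_oh_poly_add:
  assumes "little_oh_poly x" "little_oh_poly y"
  shows "little_oh_poly (\<lambda>t. x t + y t)"
proof -
  obtain r N a p where 1: "\<forall>i\<in>{1..N::nat}. 0 \<le> p i"
    "(\<lambda>t. x t - (r + (\<Sum>i=1..N. a i * t powr p i))) \<in> o[at_right 0](\<lambda>t. t)"
    using assms(1) unfolding little_oh_poly_def by blast
  obtain s M b q where 2: "\<forall>i\<in>{1..M::nat}. 0 \<le> q i"
    "(\<lambda>t. y t - (s + (\<Sum>i=1..M. b i * t powr q i))) \<in> o[at_right 0](\<lambda>t. t)"
    using assms(2) unfolding little_oh_poly_def by blast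
  define c where "c i = (if i \<le> N then a i else b (i - N))" for i
  define e where "e i = (if i \<le> N then p i else q (i - N))" for i
  have S: "(\<Sum>i=1..N+M. c i * t powr e i) =
      (\<Sum>i=1..N. a i * t powr p i) + (\<Sum>i=1..M. b i * t powr q i)" for t
  proof -
    have "(\<Sum>i=1..N+M. c i * t powr e i) =
        (\<Sum>i=1..N. c i * t powr e i) + (\<Sum>i=N+1..N+M. c i * t powr e i)"
      by (rule sum.ub_add_nat) simp
    also have "(\<Sum>i=N+1..N+M. c i * t powr e i) = (\<Sum>i=1..M. c (i+N) * t powr e (i+N))"
      using sum.shift_bounds_cl_nat_ivl[of "\<lambda>i. c i * t powr e i" 1 N M] by (simp add: add.commute)
    finally show ?thesis by (simp add: c_def e_def)
  qed
  have "0 \<le> e i" if "i \<in> {1..N+M}" for i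
  proof (cases "i \<le> N")
    case True
    then show ?thesis using that 1(1) by (simp add: e_def)
  next
    case False
    then have "i - N \<in> {1..M}" using that by auto
    then show ?thesis using False 2(1) by (simp add: e_def)
  qed
  then have "\<forall>i\<in>{1..N+M}. 0 \<le> e i" ..
  moreover have "(\<lambda>t. (x t + y t) - ((r + s) + (\<Sum>i=1..N+M. c i * t powr e i)))
      \<in> o[at_right 0](\<lambda>t. t)"
    unfolding S using sum_in_smallo(1)[OF 1(2) 2(2)] by (simp add: algebra_simps)
  ultimately show ?thesis unfolding little_oh_poly_def by blast
qed

lemma powr_in_bigo_1:
  assumes "0 \<le> p"
  shows "(\<lambda>t. t powr p) \<in> O[at_right (0::real)](\<lambda>_. 1)"
proof (rule bigoI[of _ 1])
  show "\<forall>\<^sub>F t in at_right 0. norm (t powr p) \<le> 1 * norm (1::real)"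
    using eventually_at_right_0_pos by eventually_elim (use assms in \<open>auto simp: powr_le1\<close>)
qed

lemma id_in_bigo_1: "(\<lambda>t. t) \<in> O[at_right (0::real)](\<lambda>_. 1)"
proof (rule bigoI[of _ 1])
  show "\<forall>\<^sub>F t in at_right (0::real). norm t \<le> 1 * norm (1::real)"
    by (rule eventually_mono[OF eventually_at_right_0_pos]) auto
qed

lemma little_oh_poly_bigo_1:
  assumes "little_oh_poly x"
  shows "x \<in> O[at_right 0](\<lambda>_. 1)"
proof -
  obtain r N a p where 1: "\<forall>i\<in>{1..N::nat}. 0 \<le> p i"
    "(\<lambda>t. x t - (r + (\<Sum>i=1..N. a i * t powr p i))) \<in> o[at_right 0](\<lambda>t. t)"
    using assms(1) unfolding little_oh_poly_def by blast
  have "(\<lambda>t. x t - (r + (\<Sum>i=1..N. a i * t powr p i))) \<in> O[at_right 0](\<lambda>_. 1)"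
    using landau_o.small_imp_big[OF 1(2)] id_in_bigo_1 landau_o.big_trans by blast
  moreover have "(\<lambda>t. \<Sum>i=1..N. a i * t powr p i) \<in> O[at_right 0](\<lambda>_. 1)"
    by (rule big_sum_in_bigo) (use 1(1) powr_in_bigo_1 in auto)
  then have "(\<lambda>t. r + (\<Sum>i=1..N. a i * t powr p i)) \<in> O[at_right 0](\<lambda>_. 1)"
    by (intro sum_in_bigo) auto
  ultimately have "(\<lambda>t. (x t - (r + (\<Sum>i=1..N. a i * t powr p i))) +
      (r + (\<Sum>i=1..N. a i * t powr p i))) \<in> O[at_right 0](\<lambda>_. 1)"
    by (rule sum_in_bigo(1))
  then show ?thesis by simp
qed

lemma smallo_mult_little_oh_poly:
  assumes "x \<in> o[at_right 0](\<lambda>t. t)" "little_oh_poly y"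
  shows "(\<lambda>t. x t * y t) \<in> o[at_right 0](\<lambda>t. t)"
  using landau_o.small_big_mult[OF assms(1) little_oh_poly_bigo_1[OF assms(2)]] by simp

lemma little_oh_poly_cong:
  assumes "little_oh_poly x" "eventually (\<lambda>t. x t = y t) (at_right 0)"
  shows "little_oh_poly y"
proof -
  have "(\<lambda>t. y t - x t) \<in> o[at_right 0](\<lambda>t. t)"
    using assms(2) by (intro landau_o.smallI) (auto elim!: eventually_mono)
  then show ?thesis
    using little_oh_poly_add[OF assms(1) little_oh_poly_smallo, of "\<lambda>t. y t - x t"] by simp
qed

lemma little_oh_poly_sum:
  assumes "finite A" "\<And>i. i \<in> A \<Longrightarrow> little_oh_poly (f i)"
  shows "little_oh_poly (\<lambda>t. \<Sum>i\<in>A. f i t)"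
  using assms by (induction A rule: finite_induct)
    (auto intro!: little_oh_poly_add little_oh_poly_const)

lemma little_oh_poly_monom_mult:
  assumes "0 \<le> p" "little_oh_poly x"
  shows "little_oh_poly (\<lambda>t. c * t powr p * x t)"
proof -
  obtain r N a q where 1: "\<forall>i\<in>{1..N::nat}. 0 \<le> q i"
    "(\<lambda>t. x t - (r + (\<Sum>i=1..N. a i * t powr q i))) \<in> o[at_right 0](\<lambda>t. t)"
    using assms(2) unfolding little_oh_poly_def by blast
  let ?e = "\<lambda>t. x t - (r + (\<Sum>i=1..N. a i * t powr q i))"
  have "little_oh_poly (\<lambda>t. ?e t * (c * t powr p) +
      (c * r * t powr p + (\<Sum>i=1..N. c * a i * t powr (p + q i))))"
    using 1 assms(1)
    by (intro little_oh_poly_add little_oh_poly_sum little_oh_poly_monom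
        little_oh_poly_smallo smallo_mult_little_oh_poly) auto
  moreover have "?e t * (c * t powr p) +
      (c * r * t powr p + (\<Sum>i=1..N. c * a i * t powr (p + q i))) = c * t powr p * x t" for t
    by (simp add: powr_add algebra_simps sum_distrib_left sum_distrib_right)
  ultimately show ?thesis by simp
qed

lemma little_oh_poly_mult:
  assumes "little_oh_poly x" "little_oh_poly y"
  shows "little_oh_poly (\<lambda>t. x t * y t)"
proof -
  obtain r N a p where 1: "\<forall>i\<in>{1..N::nat}. 0 \<le> p i"
    "(\<lambda>t. x t - (r + (\<Sum>i=1..N. a i * t powr p i))) \<in> o[at_right 0](\<lambda>t. t)"
    using assms(1) unfolding little_oh_poly_def by blast
  let ?e = "\<lambda>t. x t - (r + (\<Sum>i=1..N. a i * t powr p i))"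
  have "little_oh_poly (\<lambda>t. r * t powr 0 * y t)"
    using assms(2) by (intro little_oh_poly_monom_mult) auto
  then have c: "little_oh_poly (\<lambda>t. r * y t)"
    by (rule little_oh_poly_cong) (use eventually_at_right_0_pos in eventually_elim, auto)
  have "little_oh_poly (\<lambda>t. \<Sum>i=1..N. a i * t powr p i * y t)"
    using 1(1) assms(2) by (intro little_oh_poly_sum little_oh_poly_monom_mult) auto
  moreover have "little_oh_poly (\<lambda>t. ?e t * y t)"
    using smallo_mult_little_oh_poly[OF 1(2) assms(2)] by (rule little_oh_poly_smallo)
  ultimately
  have "little_oh_poly (\<lambda>t. ?e t * y t + (r * y t + (\<Sum>i=1..N. a i * t powr p i * y t)))"
    by (intro little_oh_poly_add c)
  moreover have "?e t * y t + (r * y t + (\<Sum>i=1..N. a i * t powr p i * y t)) = x t * y t" for t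
    by (simp add: algebra_simps sum_distrib_left sum_distrib_right)
  ultimately show ?thesis by simp
qed

lemma little_oh_poly_uminus:
  assumes "little_oh_poly x"
  shows "little_oh_poly (\<lambda>t. - x t)"
  using little_oh_poly_mult[OF little_oh_poly_const[of "-1"] assms] by simp

section \<open>The ring of Fermat reals\<close>

quotient_type fermat = "real \<Rightarrow> real" / partial: fermat_rel
proof (rule part_equivpI)
  show "\<exists>x. fermat_rel x x"
    by (rule exI[of _ "\<lambda>_. 0"]) (simp add: fermat_rel_def little_oh_poly_const)
  show "symp fermat_rel"
  proof (rule sympI)
    fix x y assume *: "fermat_rel x y"
    then have "(\<lambda>t. - (x t - y t)) \<in> o[at_right 0](\<lambda>t. t)"
      unfolding fermat_rel_def landau_o.small.uminus_in_iff by blast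
    then show "fermat_rel y x" using * by (simp add: fermat_rel_def)
  qed
  show "transp fermat_rel"
  proof (rule transpI)
    fix x y z assume *: "fermat_rel x y" "fermat_rel y z"
    then have "(\<lambda>t. (x t - y t) + (y t - z t)) \<in> o[at_right 0](\<lambda>t. t)"
      unfolding fermat_rel_def by (intro sum_in_smallo(1)) simp_all
    then show "fermat_rel x z" using * by (simp add: fermat_rel_def)
  qed
qed

lemma fermat_rel_add:
  assumes "fermat_rel x x'" "fermat_rel y y'"
  shows "fermat_rel (\<lambda>t. x t + y t) (\<lambda>t. x' t + y' t)"
proof -
  have "(\<lambda>t. (x t - x' t) + (y t - y' t)) \<in> o[at_right 0](\<lambda>t. t)"
    using assms unfolding fermat_rel_def by (intro sum_in_smallo(1)) simp_all
  then show ?thesis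
    using assms by (simp add: fermat_rel_def little_oh_poly_add algebra_simps)
qed

lemma fermat_rel_mult:
  assumes "fermat_rel x x'" "fermat_rel y y'"
  shows "fermat_rel (\<lambda>t. x t * y t) (\<lambda>t. x' t * y' t)"
proof -
  have "(\<lambda>t. (x t - x' t) * y t + (y t - y' t) * x' t) \<in> o[at_right 0](\<lambda>t. t)"
    using assms unfolding fermat_rel_def
    by (intro sum_in_smallo(1) smallo_mult_little_oh_poly) simp_all
  then show ?thesis
    using assms by (simp add: fermat_rel_def little_oh_poly_mult algebra_simps)
qed

lemma fermat_rel_const: "fermat_rel (\<lambda>_. r) (\<lambda>_. r)"
  by (simp add: fermat_rel_def little_oh_poly_const)

lemma fermat_rel_uminus:
  assumes "fermat_rel x x'"
  shows "fermat_rel (\<lambda>t. - x t) (\<lambda>t. - x' t)"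
  using fermat_rel_mult[OF fermat_rel_const[of "-1"] assms] by simp

lemma fermat_rel_eqI:
  assumes "little_oh_poly x" "\<And>t. x t = y t"
  shows "fermat_rel x y"
proof -
  have "x = y" using assms(2) by (rule ext)
  then show ?thesis using assms(1) by (simp add: fermat_rel_def)
qed

lemma little_oh_poly_if_rel: "fermat_rel x x \<Longrightarrow> little_oh_poly x"
  by (simp add: fermat_rel_def)

instantiation fermat :: comm_ring_1
begin

lift_definition zero_fermat :: fermat is "\<lambda>_. 0" by (rule fermat_rel_const)

lift_definition one_fermat :: fermat is "\<lambda>_. 1" by (rule fermat_rel_const)

lift_definition plus_fermat :: "fermat \<Rightarrow> fermat \<Rightarrow> fermat" is "\<lambda>x y t. x t + y t"
  by (rule fermat_rel_add)

lift_definition times_fermat :: "fermat \<Rightarrow> fermat \<Rightarrow> fermat" is "\<lambda>x y t. x t * y t"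
  by (rule fermat_rel_mult)

lift_definition uminus_fermat :: "fermat \<Rightarrow> fermat" is "\<lambda>x t. - x t"
  by (rule fermat_rel_uminus)

definition minus_fermat :: "fermat \<Rightarrow> fermat \<Rightarrow> fermat" where
  "minus_fermat x y = x + - y"

instance
proof
  fix a b c :: fermat
  show "a * b * c = a * (b * c)"
    by transfer
      (rule fermat_rel_eqI, (intro little_oh_poly_mult; rule little_oh_poly_if_rel; assumption), simp add: algebra_simps)
  show "a * b = b * a"
    by transfer
      (rule fermat_rel_eqI, (intro little_oh_poly_mult; rule little_oh_poly_if_rel; assumption), simp add: algebra_simps)
  show "a + b + c = a + (b + c)"
    by transfer
      (rule fermat_rel_eqI, (intro little_oh_poly_add; rule little_oh_poly_if_rel; assumption), simp add: algebra_simps)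
  show "a + b = b + a"
    by transfer
      (rule fermat_rel_eqI, (intro little_oh_poly_add; rule little_oh_poly_if_rel; assumption), simp add: algebra_simps)
  show "(a + b) * c = a * c + b * c"
    by transfer
      (rule fermat_rel_eqI, (intro little_oh_poly_add little_oh_poly_mult; rule little_oh_poly_if_rel; assumption), simp add: algebra_simps)
  show "1 * a = a"
    by transfer simp
  show "0 + a = a"
    by transfer simp
  show "- a + a = 0"
    by transfer (simp add: fermat_rel_const)
  show "a - b = a + - b"
    by (rule minus_fermat_def)
  have "(\<lambda>_. 1) \<notin> o[at_right 0](\<lambda>t::real. t)"
  proof
    assume "(\<lambda>_. 1::real) \<in> o[at_right 0](\<lambda>t::real. t)"
    then have "\<forall>\<^sub>F t in at_right 0. norm (1::real) \<le> 1 * norm (t::real)"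
      by (rule landau_o.smallD) simp
    then have "\<forall>\<^sub>F t in at_right (0::real). False"
      using eventually_at_right_0_pos by eventually_elim auto
    then show False by simp
  qed
  then show "(0::fermat) \<noteq> 1"
    by transfer (simp add: fermat_rel_def)
qed

end

text \<open>The same ring in record form, so that the library's notion of ideal applies to it.\<close>

definition fermat_ring :: "fermat ring" where
  "fermat_ring = \<lparr>carrier = UNIV, mult = (*), one = 1, zero = 0, add = (+)\<rparr>"

lemma cring_fermat_ring: "cring fermat_ring"
proof (rule cringI)
  show "abelian_group fermat_ring"
  proof (rule abelian_groupI)
    fix x :: fermat
    show "\<exists>y\<in>carrier fermat_ring. y \<oplus>\<^bsub>fermat_ring\<^esub> x = \<zero>\<^bsub>fermat_ring\<^esub>"
      by (rule bexI[of _ "- x"]) (auto simp: fermat_ring_def)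
  qed (auto simp: fermat_ring_def ac_simps)
  show "comm_monoid fermat_ring"
    by (rule comm_monoidI) (auto simp: fermat_ring_def ac_simps)
qed (auto simp: fermat_ring_def algebra_simps)

lift_definition fermat_of_real :: "real \<Rightarrow> fermat" is "\<lambda>r _. r" by (rule fermat_rel_const)

text \<open>The value for nonpositive arguments is a dummy.\<close>

lift_definition dt :: "real \<Rightarrow> fermat" is "\<lambda>a t. if a > 0 then t powr (1 / a) else 0"
proof -
  fix a :: real
  show "fermat_rel (\<lambda>t. if a > 0 then t powr (1 / a) else 0) (\<lambda>t. if a > 0 then t powr (1 / a) else 0)"
  proof (cases "a > 0")
    case True
    then show ?thesis
      using little_oh_poly_monom[of "1 / a" 1] by (simp add: fermat_rel_eqI)
  next
    case False
    then show ?thesis by (simp add: fermat_rel_const)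
  qed
qed

section \<open>Decompositions\<close>

text \<open>
  \<open>is_decomposition x r [(\<alpha>\<^sub>1, a\<^sub>1), \<dots>, (\<alpha>\<^sub>N, a\<^sub>N)]\<close> states that \<open>r + \<alpha>\<^sub>1 dt a\<^sub>1 + \<dots> + \<alpha>\<^sub>N dt a\<^sub>N\<close>
  is the decomposition of \<open>x\<close>.
\<close>

definition is_decomposition :: "fermat \<Rightarrow> real \<Rightarrow> (real \<times> real) list \<Rightarrow> bool" where
  "is_decomposition x r ps \<longleftrightarrow>
     x = fermat_of_real r + (\<Sum>(\<alpha>, a)\<leftarrow>ps. fermat_of_real \<alpha> * dt a) \<and>
     (\<forall>(\<alpha>, a)\<in>set ps. \<alpha> \<noteq> 0 \<and> a \<ge> 1) \<and>
     sorted_wrt (>) (map snd ps)"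

definition decomposition :: "fermat \<Rightarrow> real \<times> (real \<times> real) list" where
  "decomposition x = (THE (r, ps). is_decomposition x r ps)"

subsection \<open>Every Fermat real has exactly one decomposition\<close>

lemma abs_fermat_eq_iff:
  assumes "little_oh_poly f" "little_oh_poly g"
  shows "abs_fermat f = abs_fermat g \<longleftrightarrow> (\<lambda>t. f t - g t) \<in> o[at_right 0](\<lambda>t. t)"
  using Quotient_rel[OF Quotient_fermat, of f g] assms by (auto simp: fermat_rel_def)

lemma abs_fermat_cases:
  obtains f where "little_oh_poly f" "x = abs_fermat f"
  using Quotient_abs_rep[OF Quotient_fermat, of x] Quotient_rep_reflp[OF Quotient_fermat, of x]
  by (auto simp: fermat_rel_def)

lemma abs_fermat_add:
  assumes "little_oh_poly f" "little_oh_poly g"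
  shows "abs_fermat f + abs_fermat g = abs_fermat (\<lambda>t. f t + g t)"
  using assms by (intro plus_fermat.abs_eq) (auto intro!: fermat_rel_eqI)

lemma abs_fermat_mult:
  assumes "little_oh_poly f" "little_oh_poly g"
  shows "abs_fermat f * abs_fermat g = abs_fermat (\<lambda>t. f t * g t)"
  using assms by (intro times_fermat.abs_eq) (auto intro!: fermat_rel_eqI)

lemma fermat_of_real_abs: "fermat_of_real r = abs_fermat (\<lambda>_. r)"
  by (rule fermat_of_real.abs_eq)

lemma fermat_of_real_add: "fermat_of_real (r + s) = fermat_of_real r + fermat_of_real s"
  by (simp add: fermat_of_real_abs abs_fermat_add little_oh_poly_const)

lemma fermat_of_real_0: "fermat_of_real 0 = 0"
  by (simp add: fermat_of_real_abs zero_fermat.abs_eq)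

lemma monom_abs:
  assumes "a > 0"
  shows "fermat_of_real \<alpha> * dt a = abs_fermat (\<lambda>t. \<alpha> * t powr (1 / a))"
proof -
  have "dt a = abs_fermat (\<lambda>t. t powr (1 / a))"
    using assms by (simp add: dt.abs_eq)
  then show ?thesis
    using abs_fermat_mult[of "\<lambda>_. \<alpha>" "\<lambda>t. t powr (1 / a)"]
      little_oh_poly_monom[of "1 / a" 1] assms
    by (simp add: fermat_of_real_abs little_oh_poly_const)
qed

lemma powr_smallo:
  assumes "p < q"
  shows "(\<lambda>t. t powr q) \<in> o[at_right (0::real)](\<lambda>t. t powr p)"
proof (rule smalloI_tendsto)
  have "((\<lambda>t::real. t powr (q - p)) \<longlongrightarrow> 0) (at_right 0)"
    using assms by (intro tendsto_zero_powrI[of _ _ _ "q - p"])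
      (auto intro!: eventually_mono[OF eventually_at_right_0_pos])
  then show "((\<lambda>t::real. t powr q / t powr p) \<longlongrightarrow> 0) (at_right 0)"
    by (simp add: powr_diff)
  show "\<forall>\<^sub>F t::real in at_right 0. t powr p \<noteq> 0"
    by (rule eventually_mono[OF eventually_at_right_0_pos]) auto
qed

lemma smallo_id_iff: "f \<in> o[at_right 0](\<lambda>t. t) \<longleftrightarrow> f \<in> o[at_right (0::real)](\<lambda>t. t powr 1)"
proof -
  have "o[at_right 0](\<lambda>t::real. t) = o[at_right 0](\<lambda>t. t powr 1)"
    by (rule landau_o.small.cong, rule eventually_mono[OF eventually_at_right_0_pos]) auto
  then show ?thesis by simp
qed

lemma dt_eq_0:
  assumes "0 < a" "a < 1"
  shows "fermat_of_real \<alpha> * dt a = 0"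
proof -
  have "(\<lambda>t. t powr (1 / a)) \<in> o[at_right (0::real)](\<lambda>t. t)"
    unfolding smallo_id_iff using assms by (intro powr_smallo) simp
  then have "(\<lambda>t. \<alpha> * t powr (1 / a)) \<in> o[at_right (0::real)](\<lambda>t. t)"
    by (cases "\<alpha> = 0") auto
  then show ?thesis
    using assms abs_fermat_eq_iff[of "\<lambda>t. \<alpha> * t powr (1 / a)" "\<lambda>_. 0"]
    by (simp add: monom_abs zero_fermat.abs_eq little_oh_poly_const little_oh_poly_monom)
qed

definition nil_part :: "(real \<times> real) list \<Rightarrow> real \<Rightarrow> real" where
  "nil_part ps t = (\<Sum>(\<alpha>, a)\<leftarrow>ps. \<alpha> * t powr (1 / a))"

lemma nil_part_simps [simp]:
  "nil_part [] t = 0"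
  "nil_part ((\<alpha>, a) # ps) t = \<alpha> * t powr (1 / a) + nil_part ps t"
  by (simp_all add: nil_part_def)

lemma nil_part_abs:
  assumes "\<forall>(\<alpha>, a)\<in>set ps. a \<ge> 1"
  shows "little_oh_poly (nil_part ps) \<and>
    (\<Sum>(\<alpha>, a)\<leftarrow>ps. fermat_of_real \<alpha> * dt a) = abs_fermat (nil_part ps)"
  using assms
proof (induction ps)
  case Nil
  have "nil_part [] = (\<lambda>_. 0)" by (rule ext) simp
  then show ?case by (simp add: little_oh_poly_const zero_fermat.abs_eq)
next
  case (Cons p ps)
  obtain \<alpha> a where p: "p = (\<alpha>, a)" by force
  have a: "a \<ge> 1" and IH: "little_oh_poly (nil_part ps)"
    "(\<Sum>(\<alpha>, a)\<leftarrow>ps. fermat_of_real \<alpha> * dt a) = abs_fermat (nil_part ps)"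
    using Cons p by auto
  have m: "little_oh_poly (\<lambda>t. \<alpha> * t powr (1 / a))"
    using a by (intro little_oh_poly_monom) simp
  have e: "nil_part (p # ps) = (\<lambda>t. \<alpha> * t powr (1 / a) + nil_part ps t)"
    by (rule ext) (simp add: p)
  show ?case
    unfolding e using a IH m by (simp add: p monom_abs abs_fermat_add little_oh_poly_add)
qed

lemma is_decomposition_abs:
  assumes "is_decomposition x r ps"
  shows "x = abs_fermat (\<lambda>t. r + nil_part ps t)" "little_oh_poly (\<lambda>t. r + nil_part ps t)"
proof -
  have "\<forall>(\<alpha>, a)\<in>set ps. a \<ge> 1"
    using assms by (auto simp: is_decomposition_def)
  from nil_part_abs[OF this] assms
  show "x = abs_fermat (\<lambda>t. r + nil_part ps t)" "little_oh_poly (\<lambda>t. r + nil_part ps t)"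
    by (auto simp: is_decomposition_def fermat_of_real_abs abs_fermat_add
        little_oh_poly_const little_oh_poly_add)
qed

lemma nil_part_smallo:
  assumes "\<forall>(\<alpha>, a)\<in>set ps. q < 1 / a"
  shows "nil_part ps \<in> o[at_right 0](\<lambda>t. t powr q)"
  using assms
proof (induction ps)
  case Nil
  have "nil_part [] = (\<lambda>_. 0)" by (rule ext) simp
  then show ?case by simp
next
  case (Cons p ps)
  obtain \<alpha> a where p: "p = (\<alpha>, a)" by force
  have e: "nil_part (p # ps) = (\<lambda>t. \<alpha> * t powr (1 / a) + nil_part ps t)"
    by (rule ext) (simp add: p)
  have "(\<lambda>t. t powr (1 / a)) \<in> o[at_right 0](\<lambda>t. t powr q)"
    using Cons.prems p by (intro powr_smallo) auto
  then have "(\<lambda>t. \<alpha> * t powr (1 / a)) \<in> o[at_right 0](\<lambda>t. t powr q)"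
    by (cases "\<alpha> = 0") auto
  moreover have "nil_part ps \<in> o[at_right 0](\<lambda>t. t powr q)"
    using Cons by auto
  ultimately show ?case unfolding e by (rule sum_in_smallo(1))
qed

lemma powr_coeff_0:
  assumes "(\<lambda>t. c * t powr q) \<in> o[at_right (0::real)](\<lambda>t. t powr q)"
  shows "c = 0"
proof (rule ccontr)
  assume c: "c \<noteq> 0"
  have "\<forall>\<^sub>F t in at_right (0::real). norm (c * t powr q) \<le> (\<bar>c\<bar> / 2) * norm (t powr q)"
    using c by (intro landau_o.smallD[OF assms]) simp
  then have "\<forall>\<^sub>F t in at_right (0::real). False"
    using eventually_at_right_0_pos
  proof eventually_elim
    case (elim t)
    then have "\<bar>c\<bar> * t powr q \<le> (\<bar>c\<bar> / 2) * t powr q" "t powr q > 0"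
      by (auto simp: abs_mult)
    then show ?case using c by simp
  qed
  then show False by simp
qed

lemma head_smallo:
  assumes "sorted_wrt (>) (a # map snd ps)" "\<forall>(\<alpha>, a)\<in>set ps. a \<ge> 1"
  shows "nil_part ps \<in> o[at_right 0](\<lambda>t. t powr (1 / a))"
proof (rule nil_part_smallo, safe)
  fix \<beta> b assume "(\<beta>, b) \<in> set ps"
  then have "a > b" "b \<ge> 1" using assms by force+
  then have "a > b" "a * b > 0" by simp_all
  then show "1 / a < 1 / b" by (rule divide_strict_left_mono[OF _ zero_less_one])
qed

lemma smallo_id_le:
  assumes "f \<in> o[at_right (0::real)](\<lambda>t. t)" "a \<ge> 1"
  shows "f \<in> o[at_right (0::real)](\<lambda>t. t powr (1 / a))"
proof (cases "a = 1")
  case True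
  show ?thesis
    unfolding True div_by_1 using assms(1) by (rule smallo_id_iff[THEN iffD1])
next
  case False
  then have "(\<lambda>t. t powr 1) \<in> o[at_right (0::real)](\<lambda>t. t powr (1 / a))"
    using assms(2) by (intro powr_smallo) simp
  then show ?thesis
    using assms(1) unfolding smallo_id_iff by (rule landau_o.small_trans[rotated])
qed

lemma nil_part_unique:
  assumes "\<forall>(\<alpha>, a)\<in>set ps. \<alpha> \<noteq> 0 \<and> a \<ge> 1" "sorted_wrt (>) (map snd ps)"
    and "\<forall>(\<alpha>, a)\<in>set qs. \<alpha> \<noteq> 0 \<and> a \<ge> 1" "sorted_wrt (>) (map snd qs)"
    and "(\<lambda>t. nil_part ps t - nil_part qs t) \<in> o[at_right 0](\<lambda>t. t)"
  shows "ps = qs"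
proof -
  have lead: False
    if *: "\<forall>(\<alpha>, a)\<in>set ((\<alpha>, a) # ps). \<alpha> \<noteq> 0 \<and> a \<ge> 1" "sorted_wrt (>) (a # map snd ps)"
      "\<forall>(\<alpha>, a)\<in>set qs. a \<ge> 1" "sorted_wrt (>) (a # map snd qs)"
      "(\<lambda>t. nil_part ((\<alpha>, a) # ps) t - nil_part qs t) \<in> o[at_right 0](\<lambda>t. t)" for \<alpha> a ps qs
  proof -
    have "(\<lambda>t. nil_part ((\<alpha>, a) # ps) t - nil_part qs t) \<in> o[at_right 0](\<lambda>t. t powr (1 / a))"
      using *(1,5) by (intro smallo_id_le) auto
    moreover have "nil_part ps \<in> o[at_right 0](\<lambda>t. t powr (1 / a))"
      using *(1,2) by (intro head_smallo) auto
    moreover have "nil_part qs \<in> o[at_right 0](\<lambda>t. t powr (1 / a))"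
      using *(3,4) by (intro head_smallo)
    ultimately have "(\<lambda>t. (nil_part ((\<alpha>, a) # ps) t - nil_part qs t) - nil_part ps t + nil_part qs t)
        \<in> o[at_right 0](\<lambda>t. t powr (1 / a))"
      using sum_in_smallo(1)[OF sum_in_smallo(2)] by blast
    then have "\<alpha> = 0" by (intro powr_coeff_0[of \<alpha> "1 / a"]) simp
    then show False using *(1) by simp
  qed
  have swap: "(\<lambda>t. g t - f t) \<in> o[at_right 0](\<lambda>t. t)"
    if "(\<lambda>t. f t - g t) \<in> o[at_right 0](\<lambda>t. t)" for f g :: "real \<Rightarrow> real"
    using that landau_o.small.uminus_in_iff[of "\<lambda>t. f t - g t"] by simp
  show ?thesis
    using assms
  proof (induction ps arbitrary: qs)
    case Nil
    show ?case
    proof (cases qs)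
      case (Cons q qs')
      obtain \<beta> b where q: "q = (\<beta>, b)" by force
      have False
        by (rule lead[of \<beta> b qs' "[]"]) (use Nil swap[OF Nil(5)] Cons q in auto)
      then show ?thesis ..
    qed simp
  next
    case (Cons p ps)
    obtain \<alpha> a where p: "p = (\<alpha>, a)" by force
    show ?case
    proof (cases qs)
      case Nil
      have False
        by (rule lead[of \<alpha> a ps "[]"]) (use Cons.prems Nil p in auto)
      then show ?thesis ..
    next
      case qs: (Cons q qs')
      obtain \<beta> b where q: "q = (\<beta>, b)" by force
      have "\<not> a > b"
      proof
        assume "a > b"
        show False
          by (rule lead[of \<alpha> a ps qs]) (use Cons.prems qs p q \<open>a > b\<close> in auto)
      qed
      moreover have "\<not> a < b"
      proof
        assume "a < b"
        show False
          by (rule lead[of \<beta> b qs' "p # ps"])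
            (use Cons.prems swap[OF Cons.prems(5)] qs p q \<open>a < b\<close> in auto)
      qed
      ultimately have ab: "a = b" by simp
      have ps': "nil_part ps \<in> o[at_right 0](\<lambda>t. t powr (1 / a))"
        using Cons.prems(1,2) p by (intro head_smallo) auto
      have qs'': "nil_part qs' \<in> o[at_right 0](\<lambda>t. t powr (1 / a))"
        using Cons.prems(3,4) qs q ab by (intro head_smallo) auto
      have "(\<lambda>t. nil_part (p # ps) t - nil_part qs t) \<in> o[at_right 0](\<lambda>t. t powr (1 / a))"
        using Cons.prems(1,5) p by (intro smallo_id_le) auto
      from sum_in_smallo(1)[OF sum_in_smallo(2)[OF this ps'] qs'']
      have "\<alpha> - \<beta> = 0"
        by (intro powr_coeff_0[of "\<alpha> - \<beta>" "1 / a"]) (simp add: p q qs ab algebra_simps)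
      then have pq: "p = q" by (simp add: p q ab)
      have "(\<lambda>t. nil_part ps t - nil_part qs' t) \<in> o[at_right 0](\<lambda>t. t)"
        using Cons.prems(5) by (simp add: qs p flip: pq)
      then have "ps = qs'"
        using Cons.prems qs by (intro Cons.IH) auto
      then show ?thesis by (simp add: qs pq)
    qed
  qed
qed

lemma is_decomposition_unique:
  assumes "is_decomposition x r ps" "is_decomposition x s qs"
  shows "r = s \<and> ps = qs"
proof -
  note ps = is_decomposition_abs[OF assms(1)]
  note qs = is_decomposition_abs[OF assms(2)]
  have d: "(\<lambda>t. (r + nil_part ps t) - (s + nil_part qs t)) \<in> o[at_right 0](\<lambda>t. t)"
    using abs_fermat_eq_iff[OF ps(2) qs(2)] ps(1) qs(1) by simp
  have "(\<lambda>t::real. t powr 1) \<in> o[at_right 0](\<lambda>t. t powr 0)"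
    by (rule powr_smallo) simp
  with d have "(\<lambda>t. (r + nil_part ps t) - (s + nil_part qs t)) \<in> o[at_right 0](\<lambda>t. t powr 0)"
    unfolding smallo_id_iff by (rule landau_o.small_trans)
  moreover have "nil_part ps \<in> o[at_right 0](\<lambda>t. t powr 0)"
    using assms(1) by (intro nil_part_smallo) (auto simp: is_decomposition_def)
  moreover have "nil_part qs \<in> o[at_right 0](\<lambda>t. t powr 0)"
    using assms(2) by (intro nil_part_smallo) (auto simp: is_decomposition_def)
  ultimately have "(\<lambda>t. (r + nil_part ps t) - (s + nil_part qs t) - nil_part ps t + nil_part qs t)
      \<in> o[at_right 0](\<lambda>t. t powr 0)"
    using sum_in_smallo(1)[OF sum_in_smallo(2)] by blast
  then have "(\<lambda>t. r - s) \<in> o[at_right (0::real)](\<lambda>t. t powr 0)"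
    by simp
  moreover have "(\<lambda>t. r - s) \<in> o[at_right (0::real)](\<lambda>t. t powr 0) \<longleftrightarrow>
      (\<lambda>t. (r - s) * t powr 0) \<in> o[at_right (0::real)](\<lambda>t. t powr 0)"
    by (rule landau_o.small.in_cong, rule eventually_mono[OF eventually_at_right_0_pos]) auto
  ultimately have "r - s = 0" by (intro powr_coeff_0[of "r - s" 0]) blast
  then have rs: "r = s" by simp
  have "ps = qs"
  proof (rule nil_part_unique)
    show "(\<lambda>t. nil_part ps t - nil_part qs t) \<in> o[at_right 0](\<lambda>t. t)"
      using d rs by simp
  qed (use assms in \<open>simp_all add: is_decomposition_def\<close>)
  with rs show ?thesis ..
qed

lemma decomposition_insert:
  assumes "\<forall>(\<alpha>, a)\<in>set ps. \<alpha> \<noteq> 0 \<and> a \<ge> 1" "sorted_wrt (>) (map snd ps)" "\<beta> \<noteq> 0" "b \<ge> 1"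
  shows "\<exists>qs. (\<Sum>(\<alpha>, a)\<leftarrow>qs. fermat_of_real \<alpha> * dt a) =
      (\<Sum>(\<alpha>, a)\<leftarrow>ps. fermat_of_real \<alpha> * dt a) + fermat_of_real \<beta> * dt b \<and>
    (\<forall>(\<alpha>, a)\<in>set qs. \<alpha> \<noteq> 0 \<and> a \<ge> 1) \<and> sorted_wrt (>) (map snd qs) \<and>
    snd ` set qs \<subseteq> insert b (snd ` set ps)"
  using assms
proof (induction ps)
  case Nil
  show ?case by (rule exI[of _ "[(\<beta>, b)]"]) (use Nil in simp)
next
  case (Cons p ps)
  obtain \<alpha> a where p: "p = (\<alpha>, a)" by force
  consider "b > a" | "b = a" "\<alpha> + \<beta> = 0" | "b = a" "\<alpha> + \<beta> \<noteq> 0" | "b < a" by linarith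
  then show ?case
  proof cases
    case 1
    show ?thesis
      by (rule exI[of _ "(\<beta>, b) # p # ps"]) (use Cons.prems p 1 in auto)
  next
    case 2
    have "fermat_of_real \<alpha> * dt a + fermat_of_real \<beta> * dt b = fermat_of_real (\<alpha> + \<beta>) * dt a"
      by (simp add: 2(1) fermat_of_real_add algebra_simps)
    also have "\<dots> = 0" by (simp add: 2 fermat_of_real_0)
    finally have z: "fermat_of_real \<alpha> * dt a + fermat_of_real \<beta> * dt b = 0" .
    show ?thesis
    proof (intro exI[of _ ps] conjI)
      show "(\<Sum>(\<alpha>, a)\<leftarrow>ps. fermat_of_real \<alpha> * dt a) =
          (\<Sum>(\<alpha>, a)\<leftarrow>p # ps. fermat_of_real \<alpha> * dt a) + fermat_of_real \<beta> * dt b"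
        using z by (simp add: p algebra_simps)
    qed (use Cons.prems p in auto)
  next
    case 3
    show ?thesis
      by (rule exI[of _ "(\<alpha> + \<beta>, a) # ps"])
        (use Cons.prems p 3 in \<open>auto simp: fermat_of_real_add algebra_simps\<close>)
  next
    case 4
    obtain qs where qs: "(\<Sum>(\<alpha>, a)\<leftarrow>qs. fermat_of_real \<alpha> * dt a) =
        (\<Sum>(\<alpha>, a)\<leftarrow>ps. fermat_of_real \<alpha> * dt a) + fermat_of_real \<beta> * dt b"
      "\<forall>(\<alpha>, a)\<in>set qs. \<alpha> \<noteq> 0 \<and> a \<ge> 1" "sorted_wrt (>) (map snd qs)"
      "snd ` set qs \<subseteq> insert b (snd ` set ps)"
      using Cons by auto
    have "\<forall>y\<in>insert b (snd ` set ps). y < a"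
      using Cons.prems(2) 4 p by auto
    then have "\<forall>y\<in>snd ` set qs. y < a"
      using qs(4) by blast
    then have "sorted_wrt (>) (map snd (p # qs))"
      using qs(3) p by simp
    then show ?thesis
      by (intro exI[of _ "p # qs"]) (use Cons.prems qs p in \<open>auto simp: add.assoc\<close>)
  qed
qed

lemma decomposition_add_monom:
  assumes "is_decomposition x r ps" "b > 0"
  shows "\<exists>qs. is_decomposition (x + fermat_of_real \<beta> * dt b) r qs"
proof (cases "\<beta> = 0 \<or> b < 1")
  case True
  then have "fermat_of_real \<beta> * dt b = 0"
    using dt_eq_0[OF assms(2)] by (auto simp: fermat_of_real_0)
  then show ?thesis using assms(1) by auto
next
  case False
  have "\<forall>(\<alpha>, a)\<in>set ps. \<alpha> \<noteq> 0 \<and> a \<ge> 1" "sorted_wrt (>) (map snd ps)" "\<beta> \<noteq> 0" "b \<ge> 1"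
    using assms False by (auto simp: is_decomposition_def)
  from decomposition_insert[OF this] obtain qs where
    "(\<Sum>(\<alpha>, a)\<leftarrow>qs. fermat_of_real \<alpha> * dt a) =
      (\<Sum>(\<alpha>, a)\<leftarrow>ps. fermat_of_real \<alpha> * dt a) + fermat_of_real \<beta> * dt b"
    "\<forall>(\<alpha>, a)\<in>set qs. \<alpha> \<noteq> 0 \<and> a \<ge> 1" "sorted_wrt (>) (map snd qs)"
    by blast
  then have "is_decomposition (x + fermat_of_real \<beta> * dt b) r qs"
    using assms(1) by (simp add: is_decomposition_def add.assoc)
  then show ?thesis ..
qed

lemma decomposition_add_const:
  assumes "is_decomposition x r ps"
  shows "is_decomposition (x + fermat_of_real s) (r + s) ps"
  using assms by (simp add: is_decomposition_def fermat_of_real_add ac_simps)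

lemma is_decomposition_exists: "\<exists>r ps. is_decomposition x r ps"
proof -
  obtain f where f: "little_oh_poly f" "x = abs_fermat f"
    by (rule abs_fermat_cases)
  obtain r N a p where fN: "\<forall>i\<in>{1..N::nat}. 0 \<le> p i"
    "(\<lambda>t. f t - (r + (\<Sum>i=1..N. a i * t powr p i))) \<in> o[at_right 0](\<lambda>t. t)"
    using f(1) unfolding little_oh_poly_def by blast
  have "little_oh_poly (\<lambda>t. r + (\<Sum>i=1..n. a i * t powr p i)) \<and>
     (\<exists>s ps. is_decomposition (abs_fermat (\<lambda>t. r + (\<Sum>i=1..n. a i * t powr p i))) s ps)"
    if "n \<le> N" for n
    using that
  proof (induction n)
    case 0
    have "is_decomposition (abs_fermat (\<lambda>t. r)) r []"
      by (simp add: is_decomposition_def fermat_of_real_abs)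
    then show ?case by (auto simp: little_oh_poly_const)
  next
    case (Suc n)
    let ?g = "\<lambda>t. r + (\<Sum>i=1..n. a i * t powr p i)"
    let ?m = "\<lambda>t. a (Suc n) * t powr p (Suc n)"
    obtain s ps where IH: "little_oh_poly ?g" "is_decomposition (abs_fermat ?g) s ps"
      using Suc by auto
    have pos: "0 \<le> p (Suc n)" using fN(1) Suc.prems by auto
    then have m: "little_oh_poly ?m" by (rule little_oh_poly_monom)
    have e: "(\<lambda>t. r + (\<Sum>i=1..Suc n. a i * t powr p i)) = (\<lambda>t. ?g t + ?m t)"
      by (simp add: add.assoc)
    have "\<exists>s ps. is_decomposition (abs_fermat ?g + abs_fermat ?m) s ps"
    proof (cases "p (Suc n) = 0")
      case True
      have "(\<lambda>t. ?m t - a (Suc n)) \<in> o[at_right 0](\<lambda>t. t)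
          \<longleftrightarrow> (\<lambda>_. 0) \<in> o[at_right (0::real)](\<lambda>t. t)"
        by (rule landau_o.small.in_cong, rule eventually_mono[OF eventually_at_right_0_pos])
          (auto simp: True)
      then have "abs_fermat ?m = fermat_of_real (a (Suc n))"
        using abs_fermat_eq_iff[OF m little_oh_poly_const] by (simp add: fermat_of_real_abs)
      then show ?thesis using decomposition_add_const[OF IH(2)] by auto
    next
      case False
      then have "abs_fermat ?m = fermat_of_real (a (Suc n)) * dt (1 / p (Suc n))"
        using pos by (subst monom_abs) auto
      then show ?thesis
        using decomposition_add_monom[OF IH(2), of "1 / p (Suc n)" "a (Suc n)"] False pos by auto
    qed
    then show ?case
      unfolding e using IH(1) m by (simp add: little_oh_poly_add abs_fermat_add)
  qed
  from this[of N] show ?thesis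
    using abs_fermat_eq_iff[OF f(1), of "\<lambda>t. r + (\<Sum>i=1..N. a i * t powr p i)"] f(2) fN(2)
    by auto
qed

lemma decomposition_eqI:
  assumes "is_decomposition x r ps"
  shows "decomposition x = (r, ps)"
  unfolding decomposition_def
proof (rule the_equality)
  show "case (r, ps) of (r, ps) \<Rightarrow> is_decomposition x r ps"
    using assms by simp
  show "p = (r, ps)" if "case p of (r, ps) \<Rightarrow> is_decomposition x r ps" for p
    using that is_decomposition_unique[OF assms] by (cases p) auto
qed

lemma is_decomposition_decomposition:
  "is_decomposition x (fst (decomposition x)) (snd (decomposition x))"
  using is_decomposition_exists[of x] decomposition_eqI by force

subsection \<open>Standard part, order and the order relation\<close>

definition std_part :: "fermat \<Rightarrow> real" where
  "std_part x = fst (decomposition x)"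

definition fermat_order :: "fermat \<Rightarrow> real" where
  "fermat_order x = (case snd (decomposition x) of [] \<Rightarrow> 0 | (\<alpha>, a) # _ \<Rightarrow> a)"

text \<open>
  If the standard part is zero, then \<open>x \<noteq> 0\<close> means that the list of the decomposition is
  nonempty.
\<close>

definition fermat_pos :: "fermat \<Rightarrow> bool" where
  "fermat_pos x \<longleftrightarrow> std_part x > 0 \<or>
     (std_part x = 0 \<and> x \<noteq> 0 \<and> fst (hd (snd (decomposition x))) > 0)"

instantiation fermat :: ord
begin

definition less_fermat :: "fermat \<Rightarrow> fermat \<Rightarrow> bool" where
  "x < y \<longleftrightarrow> fermat_pos (y - x)"

definition less_eq_fermat :: "fermat \<Rightarrow> fermat \<Rightarrow> bool" where
  "x \<le> y \<longleftrightarrow> x < y \<or> x = (y::fermat)"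

instance ..

end

definition fermat_D_infty :: "fermat set" where
  "fermat_D_infty = {x. std_part x = 0}"

text \<open>
  The parameter of \<open>fermat_D\<close> ranges over the nonnegative extended reals; \<^typ>\<open>ereal\<close> supplies the
  convention that adding or subtracting 1 leaves infinity unchanged.
\<close>

definition fermat_D :: "ereal \<Rightarrow> fermat set" where
  "fermat_D c = {x. std_part x = 0 \<and> ereal (fermat_order x) < c + 1}"

lemma fermat_D_infinity: "fermat_D \<infinity> = fermat_D_infty"
  by (simp add: fermat_D_def fermat_D_infty_def)

definition fermat_I :: "ereal \<Rightarrow> fermat set" where
  "fermat_I a = {x \<in> fermat_D_infty. ereal (fermat_order x) \<le> a}"

definition orders :: "fermat set \<Rightarrow> real set" where
  "orders J = fermat_order ` J"

end

theory Submission
  imports Defs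
begin

text \<open>
  An element with nonzero standard part is a nonzero real plus a sum of nilpotent monomials, hence
  a unit. Factoring the leading monomial \<open>dt b\<close> out of a nonzero infinitesimal \<open>y\<close> of order \<open>b\<close>
  leaves such a unit, so \<open>y\<close> divides \<open>dt b\<close>, and therefore every infinitesimal of order at most
  \<open>b\<close>. Consequently membership of infinitesimals in an ideal depends only on their order, and all
  three claims follow; for the first, \<open>- b < c < b\<close> forces the order of \<open>c\<close> not to exceed that of \<open>b\<close>.
\<close>

section \<open>Monomials and units\<close>

text \<open>Unlike \<open>dt (1 / p)\<close>, this has the intended value 1 at \<open>p = 0\<close>.\<close>

definition monom_fermat :: "real \<Rightarrow> fermat" where
  "monom_fermat p = abs_fermat (\<lambda>t. t powr p)"

lemma little_oh_poly_powr: "0 \<le> p \<Longrightarrow> little_oh_poly (\<lambda>t. t powr p)"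
  using little_oh_poly_monom[of p 1] by simp

lemma dt_eq_monom: "0 < a \<Longrightarrow> dt a = monom_fermat (1 / a)"
  by (simp add: dt.abs_eq monom_fermat_def)

lemma monom_fermat_add:
  assumes "0 \<le> p" "0 \<le> q"
  shows "monom_fermat (p + q) = monom_fermat p * monom_fermat q"
  using assms by (simp add: monom_fermat_def abs_fermat_mult little_oh_poly_powr powr_add)

lemma monom_fermat_0: "monom_fermat 0 = 1"
proof -
  \<comment> \<open>\<open>0 powr 0\<close> is 0, so the representatives differ at 0; they agree
    along the filter.\<close>
  have "(\<lambda>t. t powr 0 - 1) \<in> o[at_right (0::real)](\<lambda>t. t)
      \<longleftrightarrow> (\<lambda>_. 0) \<in> o[at_right (0::real)](\<lambda>t. t)"
    by (rule landau_o.small.in_cong, rule eventually_mono[OF eventually_at_right_0_pos]) auto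
  then show ?thesis
    using abs_fermat_eq_iff[OF little_oh_poly_powr[of 0] little_oh_poly_const[of 1]]
    by (simp add: monom_fermat_def one_fermat.abs_eq)
qed

lemma monom_fermat_eq_0:
  assumes "p > 1"
  shows "monom_fermat p = 0"
proof -
  have "(\<lambda>t. t powr p) \<in> o[at_right (0::real)](\<lambda>t. t)"
    unfolding smallo_id_iff using assms by (rule powr_smallo)
  then show ?thesis
    using abs_fermat_eq_iff[OF little_oh_poly_powr[of p] little_oh_poly_const[of 0]] assms
    by (simp add: monom_fermat_def zero_fermat.abs_eq)
qed

lemma monom_fermat_power:
  assumes "0 \<le> p"
  shows "monom_fermat p ^ n = monom_fermat (real n * p)"
proof (induction n)
  case (Suc n)
  then show ?case
    using assms monom_fermat_add[of p "real n * p"] by (simp add: distrib_right)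
qed (simp add: monom_fermat_0)

text \<open>Powers multiply the exponent, and a function with exponent above 1 is o(t).\<close>

lemma monom_fermat_nilpotent:
  assumes "0 < p"
  shows "\<exists>n. monom_fermat p ^ n = 0"
proof -
  obtain n where "1 < real n * p"
    using reals_Archimedean3[OF assms] by blast
  then show ?thesis
    using assms by (metis monom_fermat_power monom_fermat_eq_0 less_imp_le)
qed

text \<open>\<open>u - (- y)\<close> divides \<open>u ^ n - (- y) ^ n\<close>, which is the unit
  \<open>u ^ n\<close>.\<close>

lemma unit_add_nilpotent:
  fixes u :: "'a :: comm_ring_1"
  assumes "u dvd 1" "y ^ n = 0"
  shows "u + y dvd 1"
proof -
  have "u - (- y) dvd u ^ n - (- y) ^ n"
    by (metis power_diff_sumr2 dvd_triv_left)
  also have "(- y) ^ n = 0"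
    using assms(2) by (simp add: power_minus[of y n])
  also have "u ^ n - 0 dvd 1"
    using dvd_power_same[OF assms(1), of n] by simp
  finally show ?thesis by simp
qed

lemma fermat_of_real_mult: "fermat_of_real (r * s) = fermat_of_real r * fermat_of_real s"
  by (simp add: fermat_of_real_abs abs_fermat_mult little_oh_poly_const)

lemma fermat_of_real_unit:
  assumes "r \<noteq> 0"
  shows "fermat_of_real r dvd 1"
proof -
  have "fermat_of_real r * fermat_of_real (1 / r) = fermat_of_real 1"
    using assms by (simp flip: fermat_of_real_mult)
  then show ?thesis
    by (metis dvd_triv_left fermat_of_real_abs one_fermat.abs_eq)
qed

text \<open>Each summand is nilpotent and is added to a unit. Listing exponents instead of orders
  lets the lemma also cover a decomposition divided by its leading monomial.\<close>

lemma unit_real_plus_monoms: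
  assumes "r \<noteq> 0" "\<forall>(\<alpha>, p)\<in>set ps. 0 < p"
  shows "fermat_of_real r + (\<Sum>(\<alpha>, p)\<leftarrow>ps. fermat_of_real \<alpha> * monom_fermat p) dvd 1"
  using assms(2)
proof (induction ps)
  case Nil
  then show ?case using fermat_of_real_unit[OF assms(1)] by simp
next
  case (Cons q ps)
  obtain \<alpha> p where q: "q = (\<alpha>, p)" by force
  obtain n where "monom_fermat p ^ n = 0"
    using monom_fermat_nilpotent Cons.prems q by auto
  then have "(fermat_of_real \<alpha> * monom_fermat p) ^ n = 0"
    by (simp add: power_mult_distrib)
  then have "fermat_of_real r + (\<Sum>(\<alpha>, p)\<leftarrow>ps. fermat_of_real \<alpha> * monom_fermat p) +
      fermat_of_real \<alpha> * monom_fermat p dvd 1"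
    by (rule unit_add_nilpotent[rotated]) (use Cons in simp)
  then show ?case by (simp add: q ac_simps)
qed

section \<open>Divisibility and the order\<close>

text \<open>Gives access to the list behind \<open>std_part\<close> and \<open>fermat_order\<close>
  without unfolding \<open>decomposition\<close>.\<close>

lemma decomposition_cases:
  obtains ps where "is_decomposition x (std_part x) ps"
    "ps = []" "fermat_order x = 0"
  | ps \<alpha> a qs where "is_decomposition x (std_part x) ps"
    "ps = (\<alpha>, a) # qs" "fermat_order x = a" "a \<ge> 1"
proof (cases "snd (decomposition x)")
  case Nil
  then show thesis
    using is_decomposition_decomposition[of x] that(1)
    by (simp add: std_part_def fermat_order_def)
next
  case (Cons p qs)
  then show thesis
    using is_decomposition_decomposition[of x] that(2)[of _ "fst p" "snd p" qs]
    by (auto simp: std_part_def fermat_order_def is_decomposition_def split: prod.splits)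
qed

lemma std_part_eqI: "is_decomposition x r ps \<Longrightarrow> std_part x = r"
  by (simp add: std_part_def decomposition_eqI)

text \<open>This gap is what yields \<open>a \<ge> 1\<close> when the supremum is not
  attained.\<close>

lemma fermat_order_0_or_ge_1: "fermat_order x = 0 \<or> fermat_order x \<ge> 1"
  by (cases x rule: decomposition_cases) auto

lemma unit_if_std_part_nonzero:
  assumes "std_part x \<noteq> 0"
  shows "x dvd 1"
proof -
  obtain ps where ps: "is_decomposition x (std_part x) ps"
    using is_decomposition_decomposition[of x] by (auto simp: std_part_def)
  then have "\<forall>(\<alpha>, a)\<in>set ps. a \<ge> 1"
    by (auto simp: is_decomposition_def)
  then have "(\<Sum>(\<alpha>, a)\<leftarrow>ps. fermat_of_real \<alpha> * dt a) =
      (\<Sum>(\<alpha>, p)\<leftarrow>map (\<lambda>(\<alpha>, a). (\<alpha>, 1 / a)) ps. fermat_of_real \<alpha> * monom_fermat p)"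
    by (induction ps) (auto simp: dt_eq_monom)
  moreover have "fermat_of_real (std_part x) +
      (\<Sum>(\<alpha>, p)\<leftarrow>map (\<lambda>(\<alpha>, a). (\<alpha>, 1 / a)) ps. fermat_of_real \<alpha> * monom_fermat p) dvd 1"
    by (rule unit_real_plus_monoms[OF assms]) (use ps in \<open>auto simp: is_decomposition_def\<close>)
  ultimately show ?thesis
    using ps by (simp add: is_decomposition_def)
qed

text \<open>The larger order has the smaller exponent, so the difference of exponents is
  nonnegative; for \<open>a = b\<close> the cofactor is 1.\<close>

lemma dt_factor:
  assumes "0 < b" "b \<le> a"
  shows "dt b = dt a * monom_fermat (1 / b - 1 / a)"
  using assms monom_fermat_add[of "1 / a" "1 / b - 1 / a"]
  by (simp add: dt_eq_monom frac_le)

lemma decomposition_dvd_dt: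
  assumes "is_decomposition y 0 ((\<beta>, b) # ps)"
  shows "y dvd dt b"
proof -
  \<comment> \<open>The exponents left after division by \<open>dt b\<close>; they are positive
    because the orders in \<open>ps\<close> lie strictly below b.\<close>
  let ?qs = "map (\<lambda>(\<alpha>, a). (\<alpha>, 1 / a - 1 / b)) ps"
  have *: "\<forall>(\<alpha>, a)\<in>set ps. 1 \<le> a \<and> a < b" and \<beta>: "\<beta> \<noteq> 0"
    using assms by (auto simp: is_decomposition_def)
  have "(\<Sum>(\<alpha>, a)\<leftarrow>ps. fermat_of_real \<alpha> * dt a) =
      dt b * (\<Sum>(\<alpha>, p)\<leftarrow>?qs. fermat_of_real \<alpha> * monom_fermat p)"
    using *
  proof (induction ps)
    case (Cons p ps)
    obtain \<alpha> a where p: "p = (\<alpha>, a)" by force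
    have "dt a = dt b * monom_fermat (1 / a - 1 / b)"
      using Cons.prems p by (intro dt_factor) auto
    with Cons p show ?case by (simp add: algebra_simps)
  qed simp
  with assms have y: "y = dt b *
      (fermat_of_real \<beta> + (\<Sum>(\<alpha>, p)\<leftarrow>?qs. fermat_of_real \<alpha> * monom_fermat p))"
    by (simp add: is_decomposition_def fermat_of_real_0 algebra_simps)
  have "\<forall>(\<alpha>, p)\<in>set ?qs. 0 < p"
    using * by (auto simp: frac_less2)
  \<comment> \<open>The cofactor of \<open>dt b\<close> in y divides 1, so y divides
    \<open>dt b * 1\<close>.\<close>
  from unit_real_plus_monoms[OF \<beta> this] show ?thesis
    unfolding y using mult_dvd_mono[OF dvd_refl, of _ 1 "dt b"] by simp
qed

text \<open>Term by term: \<open>dt_factor\<close> makes each monomial of order at most b a multiple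
  of \<open>dt b\<close>.\<close>

lemma dt_dvd_decomposition:
  assumes "is_decomposition x 0 ps" "\<forall>(\<alpha>, a)\<in>set ps. a \<le> b"
  shows "dt b dvd x"
proof -
  have "\<forall>(\<alpha>, a)\<in>set ps. 1 \<le> a \<and> a \<le> b"
    using assms by (auto simp: is_decomposition_def)
  then have "dt b dvd (\<Sum>(\<alpha>, a)\<leftarrow>ps. fermat_of_real \<alpha> * dt a)"
  proof (induction ps)
    case (Cons p ps)
    obtain \<alpha> a where p: "p = (\<alpha>, a)" by force
    have "dt b dvd dt a"
      using Cons.prems p dt_factor[of a b] by auto
    with Cons p show ?case by simp
  qed simp
  with assms(1) show ?thesis
    by (simp add: is_decomposition_def fermat_of_real_0)
qed

text \<open>The link is \<open>dt b\<close> with b the order of y: y divides it, and it divides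
  x.\<close>

lemma dvd_if_order_le:
  assumes x: "std_part x = 0" and y: "std_part y = 0" and le: "fermat_order x \<le> fermat_order y"
  shows "y dvd x"
proof (cases x rule: decomposition_cases)
  case 1
  then have "x = 0" using x by (simp add: is_decomposition_def fermat_of_real_0)
  then show ?thesis by simp
next
  case px: (2 ps \<alpha> a qs)
  show ?thesis
  proof (cases y rule: decomposition_cases)
    case 1
    \<comment> \<open>Impossible: y has order 0, whereas x has order at least 1.\<close>
    then show ?thesis using px le by simp
  next
    case (2 us \<beta> b vs)
    have "y dvd dt b"
      using decomposition_dvd_dt 2 y by metis
    moreover have "dt b dvd x"
    proof (rule dt_dvd_decomposition)
      show "is_decomposition x 0 ps" using px x by simp
      have "a \<le> b" using px 2 le by simp
      then show "\<forall>(\<alpha>, a)\<in>set ps. a \<le> b"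
        using px by (force simp: is_decomposition_def)
    qed
    ultimately show ?thesis by (rule dvd_trans)
  qed
qed

section \<open>Standard part, order and addition\<close>

text \<open>The monomials of y are inserted one at a time, then its standard part is added.
  Cancellation may remove orders, hence only an inclusion.\<close>

lemma decomposition_add:
  assumes "is_decomposition x r ps" "is_decomposition y s qs"
  shows "\<exists>us. is_decomposition (x + y) (r + s) us \<and> snd ` set us \<subseteq> snd ` set ps \<union> snd ` set qs"
proof -
  have "\<exists>us. is_decomposition (x + (\<Sum>(\<alpha>, a)\<leftarrow>qs. fermat_of_real \<alpha> * dt a)) r us \<and>
      snd ` set us \<subseteq> snd ` set ps \<union> snd ` set qs"
    if "\<forall>(\<alpha>, a)\<in>set qs. \<alpha> \<noteq> 0 \<and> a \<ge> 1" for qs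
    using that
  proof (induction qs)
    case Nil
    then show ?case using assms(1) by auto
  next
    case (Cons q qs)
    obtain \<beta> b where q: "q = (\<beta>, b)" by force
    obtain us where us: "is_decomposition (x + (\<Sum>(\<alpha>, a)\<leftarrow>qs. fermat_of_real \<alpha> * dt a)) r us"
      "snd ` set us \<subseteq> snd ` set ps \<union> snd ` set qs"
      using Cons by auto
    have "\<forall>(\<alpha>, a)\<in>set us. \<alpha> \<noteq> 0 \<and> a \<ge> 1" "sorted_wrt (>) (map snd us)" "\<beta> \<noteq> 0" "b \<ge> 1"
      using us(1) Cons.prems q by (auto simp: is_decomposition_def)
    from decomposition_insert[OF this] obtain vs where
      vs: "(\<Sum>(\<alpha>, a)\<leftarrow>vs. fermat_of_real \<alpha> * dt a) =
        (\<Sum>(\<alpha>, a)\<leftarrow>us. fermat_of_real \<alpha> * dt a) + fermat_of_real \<beta> * dt b"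
      "\<forall>(\<alpha>, a)\<in>set vs. \<alpha> \<noteq> 0 \<and> a \<ge> 1" "sorted_wrt (>) (map snd vs)"
      "snd ` set vs \<subseteq> insert b (snd ` set us)"
      by blast
    have "is_decomposition (x + (\<Sum>(\<alpha>, a)\<leftarrow>q # qs. fermat_of_real \<alpha> * dt a)) r vs"
      using us(1) vs by (simp add: is_decomposition_def q algebra_simps)
    moreover have "snd ` set vs \<subseteq> snd ` set ps \<union> snd ` set (q # qs)"
      using subset_trans[OF vs(4) insert_mono[OF us(2)]] q by simp
    ultimately show ?case by blast
  qed
  from this[of qs] obtain us where
    us: "is_decomposition (x + (\<Sum>(\<alpha>, a)\<leftarrow>qs. fermat_of_real \<alpha> * dt a)) r us"
    "snd ` set us \<subseteq> snd ` set ps \<union> snd ` set qs"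
    using assms(2) by (auto simp: is_decomposition_def)
  have "is_decomposition (x + y) (r + s) us"
    using decomposition_add_const[OF us(1), of s] assms(2)
    by (simp add: is_decomposition_def ac_simps)
  with us(2) show ?thesis by blast
qed

lemma std_part_add: "std_part (x + y) = std_part x + std_part y"
proof -
  obtain ps qs where "is_decomposition x (std_part x) ps" "is_decomposition y (std_part y) qs"
    by (metis std_part_def is_decomposition_decomposition)
  then show ?thesis
    using decomposition_add std_part_eqI by blast
qed

section \<open>Negation, leading coefficients and comparison\<close>

lemma decomposition_uminus:
  assumes "is_decomposition x r ps"
  shows "is_decomposition (- x) (- r) (map (\<lambda>(\<alpha>, a). (- \<alpha>, a)) ps)"
proof -
  have neg: "fermat_of_real (- s) = - fermat_of_real s" for s
    using fermat_of_real_add[of "- s" s] by (simp add: fermat_of_real_0 eq_neg_iff_add_eq_0)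
  have "(\<Sum>(\<alpha>, a)\<leftarrow>map (\<lambda>(\<alpha>, a). (- \<alpha>, a)) ps. fermat_of_real \<alpha> * dt a) =
      - (\<Sum>(\<alpha>, a)\<leftarrow>ps. fermat_of_real \<alpha> * dt a)"
    by (induction ps) (auto simp: neg)
  moreover have "map snd (map (\<lambda>(\<alpha>, a). (- \<alpha>, a)) ps) = map snd ps"
    by auto
  ultimately show ?thesis
    using assms unfolding is_decomposition_def
    by (auto simp: neg simp del: map_map)
qed

lemma std_part_uminus: "std_part (- x) = - std_part x"
  by (metis decomposition_uminus is_decomposition_decomposition std_part_def std_part_eqI)

text \<open>Terms of order below a cannot cancel the leading term, so the sum keeps its coefficient
  and sign.\<close>

lemma decomposition_add_lower_order:
  assumes "is_decomposition x 0 ((\<alpha>, a) # ps)" "is_decomposition y 0 qs"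
    and "\<forall>(\<beta>, b)\<in>set qs. b < a"
  shows "\<exists>us. is_decomposition (y + x) 0 ((\<alpha>, a) # us)"
proof -
  \<comment> \<open>x without its leading term. All orders in \<open>x' + y\<close> stay below a, so
    that term can be put back in front.\<close>
  define x' where "x' = (\<Sum>(\<alpha>, a)\<leftarrow>ps. fermat_of_real \<alpha> * dt a)"
  have "is_decomposition x' 0 ps"
    using assms(1) by (simp add: is_decomposition_def x'_def fermat_of_real_0)
  from decomposition_add[OF this assms(2)] obtain us where
    us: "is_decomposition (x' + y) 0 us" "snd ` set us \<subseteq> snd ` set ps \<union> snd ` set qs"
    by auto
  have "\<forall>b\<in>snd ` set ps \<union> snd ` set qs. b < a"
    using assms by (auto simp: is_decomposition_def)
  with us(2) have "\<forall>b\<in>snd ` set us. b < a"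
    by blast
  then have "is_decomposition (y + x) 0 ((\<alpha>, a) # us)"
    using us(1) assms(1)
    by (auto simp: is_decomposition_def x'_def fermat_of_real_0 algebra_simps)
  then show ?thesis ..
qed

lemma fermat_pos_decomposition:
  assumes "fermat_pos x" "is_decomposition x 0 ((\<alpha>, a) # ps)"
  shows "\<alpha> > 0"
  using assms(1) decomposition_eqI[OF assms(2)] by (simp add: fermat_pos_def std_part_def)

text \<open>Both \<open>b + c\<close> and \<open>b - c\<close> are positive. If c had the larger
  order, their leading coefficients would be those of c and \<open>- c\<close>, which have opposite
  signs.\<close>

lemma order_le_if_between:
  assumes b: "std_part b = 0" and c: "- b < c" "c < b"
  shows "std_part c = 0 \<and> fermat_order c \<le> fermat_order b"
proof -
  have pos: "fermat_pos (b + c)" "fermat_pos (b + - c)"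
    using c by (simp_all add: less_fermat_def add.commute)
  then have "std_part (b + c) \<ge> 0" "std_part (b + - c) \<ge> 0"
    by (auto simp: fermat_pos_def)
  \<comment> \<open>As b is infinitesimal, these two standard parts are that of c and its
    negative.\<close>
  then have c0: "std_part c = 0"
    unfolding std_part_add std_part_uminus b by simp
  moreover have "fermat_order c \<le> fermat_order b"
  proof (rule ccontr)
    assume "\<not> fermat_order c \<le> fermat_order b"
    then have less: "fermat_order b < fermat_order c" by simp
    obtain qs where qs: "is_decomposition b 0 qs" "\<forall>(\<beta>, d)\<in>set qs. d \<le> fermat_order b"
    proof (cases b rule: decomposition_cases)
      case 1
      then show thesis using that[of "[]"] b by simp
    next
      case (2 us \<beta> d vs)
      then have "\<forall>(\<beta>, d)\<in>set us. d \<le> fermat_order b"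
        by (force simp: is_decomposition_def)
      then show thesis using that[of us] 2 b by simp
    qed
    from c0 obtain \<gamma> ps where ps: "is_decomposition c 0 ((\<gamma>, fermat_order c) # ps)"
    proof (cases c rule: decomposition_cases)
      case 1
      \<comment> \<open>Order 0 for c would make the order of b negative.\<close>
      then show thesis using less fermat_order_0_or_ge_1[of b] by simp
    next
      case 2
      then show thesis using that c0 by metis
    qed
    have lower: "\<forall>(\<beta>, d)\<in>set qs. d < fermat_order c"
      using qs(2) less by fastforce
    have ps': "is_decomposition (- c) 0
        ((- \<gamma>, fermat_order c) # map (\<lambda>(\<alpha>, a). (- \<alpha>, a)) ps)"
      using decomposition_uminus[OF ps] by simp
    have "\<gamma> > 0"
      using decomposition_add_lower_order[OF ps qs(1) lower] fermat_pos_decomposition[OF pos(1)]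
      by blast
    moreover have "- \<gamma> > 0"
      using decomposition_add_lower_order[OF ps' qs(1) lower] fermat_pos_decomposition[OF pos(2)]
      by blast
    ultimately show False by simp
  qed
  ultimately show ?thesis ..
qed

section \<open>Ideals\<close>

lemma ideal_dvd_closed:
  assumes "ideal J fermat_ring" "y \<in> J" "y dvd x"
  shows "x \<in> J"
proof -
  obtain z where "x = y * z" using assms(3) by blast
  then show ?thesis
    using ideal.I_r_closed[OF assms(1,2), of z] by (simp add: fermat_ring_def)
qed

text \<open>Any other element is a unit, and an ideal containing a unit is the whole ring.\<close>

lemma proper_ideal_infinitesimal:
  assumes "ideal J fermat_ring" "J \<noteq> carrier fermat_ring" "x \<in> J"
  shows "std_part x = 0"
proof (rule ccontr)
  assume "std_part x \<noteq> 0"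
  then have "x dvd z" for z
    using unit_if_std_part_nonzero dvd_trans one_dvd by blast
  then have "J = UNIV"
    using ideal_dvd_closed[OF assms(1,3)] by blast
  then show False using assms(2) by (simp add: fermat_ring_def)
qed

theorem theorem23:
  fixes J :: "fermat set" and b :: fermat and a :: ereal
  assumes J_ideal: "ideal J fermat_ring"
    and J_proper: "J \<noteq> carrier fermat_ring"
    and b: "b \<in> J"
    and a: "a = Sup (ereal ` orders J)"
  shows "(\<forall>c::fermat. - b < c \<and> c < b \<longrightarrow> c \<in> J) \<and>
    (a \<in> ereal ` orders J \<longrightarrow> J = fermat_I a) \<and>
    (a \<notin> ereal ` orders J \<longrightarrow>
       a \<ge> 1 \<and> J = fermat_D (a - 1) \<and> J = {x \<in> fermat_D_infty. ereal (fermat_order x) < a})"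
proof -
  note inf = proper_ideal_infinitesimal[OF J_ideal J_proper]
  \<comment> \<open>The common source of all three claims: such an x is a multiple of y.\<close>
  have mem: "x \<in> J" if "std_part x = 0" "y \<in> J" "fermat_order x \<le> fermat_order y" for x y
    using dvd_if_order_le[OF that(1) inf[OF that(2)] that(3)] ideal_dvd_closed[OF J_ideal that(2)]
    by blast
  have le: "ereal (fermat_order x) \<le> a" if "x \<in> J" for x
    unfolding a orders_def using that by (intro Sup_upper) auto
  have "c \<in> J" if "- b < c" "c < b" for c
    using order_le_if_between[OF inf[OF b] that] mem b by blast
  moreover have "J = fermat_I a" if attained: "a \<in> ereal ` orders J"
  proof -
    \<comment> \<open>This single j divides every infinitesimal of order at most a.\<close>
    obtain j where "j \<in> J" "a = ereal (fermat_order j)"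
      using attained by (auto simp: orders_def)
    then show ?thesis
      using mem inf le by (auto simp: fermat_I_def fermat_D_infty_def)
  qed
  moreover have "a \<ge> 1 \<and> J = fermat_D (a - 1) \<and>
      J = {x \<in> fermat_D_infty. ereal (fermat_order x) < a}"
    if notin: "a \<notin> ereal ` orders J"
  proof -
    have less: "ereal (fermat_order x) < a" if "x \<in> J" for x
      using le[OF that] notin that by (auto simp: orders_def less_le)
    \<comment> \<open>Without a largest order, each x below the supremum needs its own member j of
      larger order.\<close>
    have witness: "\<exists>j\<in>J. r < fermat_order j" if "ereal r < a" for r
      using that unfolding a less_Sup_iff by (auto simp: orders_def)
    have J: "J = {x \<in> fermat_D_infty. ereal (fermat_order x) < a}"
    proof (intro subset_antisym subsetI)
      fix x assume "x \<in> {x \<in> fermat_D_infty. ereal (fermat_order x) < a}"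
      then have x: "std_part x = 0" "ereal (fermat_order x) < a"
        by (simp_all add: fermat_D_infty_def)
      obtain j where "j \<in> J" "fermat_order x < fermat_order j"
        using witness[OF x(2)] by blast
      then show "x \<in> J"
        using mem[OF x(1)] by simp
    qed (simp add: less inf fermat_D_infty_def)
    \<comment> \<open>The order of b is nonnegative and below a, so some member has positive order,
      hence order at least 1.\<close>
    obtain j where j: "j \<in> J" "fermat_order b < fermat_order j"
      using witness[OF less[OF b]] by blast
    then have "1 \<le> fermat_order j"
      using fermat_order_0_or_ge_1[of j] fermat_order_0_or_ge_1[of b] by auto
    then have "1 \<le> a"
      using le[OF j(1)] by (metis ereal_less_eq(3) one_ereal_def order_trans)
    \<comment> \<open>\<open>fermat_D (a - 1)\<close> bounds orders by \<open>a - 1 + 1\<close>;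
      this is a, also when a is infinite.\<close>
    moreover have "a - 1 + 1 = a"
      using \<open>1 \<le> a\<close> by (cases a) (auto simp: one_ereal_def)
    then have "fermat_D (a - 1) = {x \<in> fermat_D_infty. ereal (fermat_order x) < a}"
      by (simp add: fermat_D_def fermat_D_infty_def)
    ultimately show ?thesis using J by simp
  qed
  ultimately show ?thesis by blast
qed

end
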